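(* Let $\mu>0$, let $\gamma,\alpha,b:[t_0,+\infty[\to\mathbb R^+$ be non-negative continuously differentiable functions and let $\sigma:[t_0,+\infty[\to\mathbb R^+$ be a non-negative function such that for all $t\ge t_0$: (G1) $\sigma(t)\big(\gamma(t)\alpha(t)-\dot\alpha(t)-1\big)-2\alpha(t)\dot\sigma(t)\ge0$; (G2) $\sigma(t)\big(\gamma(t)\alpha(t)-\dot\alpha(t)-1\big)-\alpha(t)\dot\sigma(t)\ge0$; (G3) $-\frac{d}{dt}\Big[\sigma(t)\Big(\sigma(t)\big(\gamma(t)\alpha(t)-\dot\alpha(t)\big)-2\alpha(t)\dot\sigma(t)\Big)\Big]\ge0$; (G4$^+$) $\frac{d}{dt}(\alpha^2\sigma^2b)(t)-\alpha(t)\sigma(t)^2b(t)\ge0$. Suppose that the set $\mathscr S$ of saddle points of $\mathcal L$ is non-empty, let $(x^\star,y^\star,\lambda^\star)\in\mathscr S$, and assume also that $\inf F(x,y)>-\infty$. Let $t\in[t_0,+\infty[\,\mapsto(x(t),y(t),\lambda(t))$ be a solution trajectory of (TRIALS). Then, for all $t\ge t_0$, $$\mathcal L(x(t),y(t),\lambda^\star)-\mathcal L(x^\star,y^\star,\lambda^\star)=\mathcal O\Big(\exp\Big(-\int_{t_0}^t\frac1{\alpha(s)}ds\Big)\Big),$$ $$\|Ax(t)+By(t)-c\|^2=\mathcal O\Big(\exp\Big(-\int_{t_0}^t\frac1{\alpha(s)}ds\Big)\Big),$$ $$-C_1\exp\Big(-\int_{t_0}^t\frac1{2\alpha(s)}ds\Big)\le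 F(x(t),y(t))-F^\star\le C_2\exp\Big(-\int_{t_0}^t\frac1{\alpha(s)}ds\Big),$$ where $C_1$ and $C_2$ are positive constants.
   Context: Standing assumptions: $\mathcal X,\mathcal Y,\mathcal Z$ are real Hilbert spaces; $f:\mathcal X\to\mathbb R$ and $g:\mathcal Y\to\mathbb R$ are convex and of class $C^1$; $A:\mathcal X\to\mathcal Z$ and $B:\mathcal Y\to\mathcal Z$ are continuous linear operators with adjoints $A^*,B^*$; $c\in\mathcal Z$; $F(x,y):=f(x)+g(y)$ on $\mathcal X\times\mathcal Y$; the problem $\min\{F(x,y): Ax+By=c\}$ has a non-empty solution set, and $F^\star$ is its optimal value. Lagrangian: $\mathcal L(x,y,\lambda):=F(x,y)+\langle\lambda,Ax+By-c\rangle$. A saddle point of $\mathcal L$ is $(x^\star,y^\star,\lambda^\star)$ with $\mathcal L(x^\star,y^\star,\lambda)\le\mathcal L(x^\star,y^\star,\lambda^\star)\le\mathcal L(x,y,\lambda^\star)$ for all $(x,y,\lambda)$; $\mathscr S$ is the set of saddle points. The system (TRIALS) is, for $t\ge t_0$, $$\begin{cases}\ddot x+\gamma(t)\dot x+b(t)\big(\nabla f(x)+A^*[\lambda+\alpha(t)\dot\lambda+\mu(Ax+By-c)]\big)=0\\ \ddot y+\gamma(t)\dot y+b(t)\big(\nabla g(y)+B^*[\lambda+\alpha(t)\dot\lambda+\mu(Ax+By-c)]\big)=0\\ \ddot\lambda+\gamma(t)\dot\lambda-b(t)\big(A(x+\alpha(t)\dot x)+B(y+\alpha(t)\dot y)-c\big)=0.\end{cases}$$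 A solution trajectory is a classical ($C^2$) solution on $[t_0,+\infty[$.
   Formalization: α is assumed strictly positive (so that the integral of 1/α exists), and σb is assumed not identically zero, since for b=0, σ=α=γ=1 constant infeasible trajectories violate the claim; σ and the bracket in (G3) are assumed differentiable, as their written derivatives require. *)

theory Defs
  imports "HOL-Analysis.Analysis" "HOL-Library.Landau_Symbols"
begin

(* Derivative on the half-line [t0, oo): two-sided for t > t0, one-sided at t = t0.
   Meaningful only together with a differentiability assumption. *)
abbreviation ddt :: "real \<Rightarrow> (real \<Rightarrow> 'a::real_normed_vector) \<Rightarrow> real \<Rightarrow> 'a" where
  "ddt t0 u t \<equiv> vector_derivative u (at t within {t0..})"

definition C1_from :: "real \<Rightarrow> (real \<Rightarrow> 'a::real_normed_vector) \<Rightarrow> bool" where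
  "C1_from t0 u \<longleftrightarrow> u differentiable_on {t0..} \<and> continuous_on {t0..} (ddt t0 u)"

definition C2_from :: "real \<Rightarrow> (real \<Rightarrow> 'a::real_normed_vector) \<Rightarrow> bool" where
  "C2_from t0 u \<longleftrightarrow> C1_from t0 u \<and> C1_from t0 (ddt t0 u)"

definition grad :: "('a::real_inner \<Rightarrow> real) \<Rightarrow> 'a \<Rightarrow> 'a" where
  "grad f x = (THE D. GDERIV f x :> D)"

(* Class C^1 on a Hilbert space; by the Riesz isometry, continuity of the gradient is
   continuity of the Frechet derivative in the operator norm. *)
definition C1_functional :: "('a::real_inner \<Rightarrow> real) \<Rightarrow> bool" where
  "C1_functional f \<longleftrightarrow> (\<forall>x. GDERIV f x :> grad f x) \<and> continuous_on UNIV (grad f)"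

definition objective :: "('x \<Rightarrow> real) \<Rightarrow> ('y \<Rightarrow> real) \<Rightarrow> 'x \<Rightarrow> 'y \<Rightarrow> real" where
  "objective f g x y = f x + g y"

definition feasible_set :: "('x \<Rightarrow> 'z) \<Rightarrow> ('y \<Rightarrow> 'z) \<Rightarrow> 'z::ab_group_add \<Rightarrow> ('x \<times> 'y) set" where
  "feasible_set A B c = {(x, y). A x + B y = c}"

definition solution_set ::
  "('x \<Rightarrow> real) \<Rightarrow> ('y \<Rightarrow> real) \<Rightarrow> ('x \<Rightarrow> 'z) \<Rightarrow> ('y \<Rightarrow> 'z) \<Rightarrow> 'z::ab_group_add \<Rightarrow> ('x \<times> 'y) set" where
  "solution_set f g A B c =
    {(x, y) \<in> feasible_set A B c.
       \<forall>(x', y') \<in> feasible_set A B c. objective f g x y \<le> objective f g x' y'}"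

(* The infimum in the reals; used only when the solution set is non-empty. *)
definition optimal_value ::
  "('x \<Rightarrow> real) \<Rightarrow> ('y \<Rightarrow> real) \<Rightarrow> ('x \<Rightarrow> 'z) \<Rightarrow> ('y \<Rightarrow> 'z) \<Rightarrow> 'z::ab_group_add \<Rightarrow> real" where
  "optimal_value f g A B c = (INF (x, y) \<in> feasible_set A B c. objective f g x y)"

definition lagrangian ::
  "('x \<Rightarrow> real) \<Rightarrow> ('y \<Rightarrow> real) \<Rightarrow> ('x \<Rightarrow> 'z) \<Rightarrow> ('y \<Rightarrow> 'z) \<Rightarrow> 'z::real_inner \<Rightarrow> 'x \<Rightarrow> 'y \<Rightarrow> 'z \<Rightarrow> real" where
  "lagrangian f g A B c x y l = objective f g x y + l \<bullet> (A x + B y - c)"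

definition saddle_points ::
  "('x \<Rightarrow> real) \<Rightarrow> ('y \<Rightarrow> real) \<Rightarrow> ('x \<Rightarrow> 'z) \<Rightarrow> ('y \<Rightarrow> 'z) \<Rightarrow> 'z::real_inner \<Rightarrow> ('x \<times> 'y \<times> 'z) set" where
  "saddle_points f g A B c =
    {(xs, ys, ls). \<forall>x y l.
       lagrangian f g A B c xs ys l \<le> lagrangian f g A B c xs ys ls \<and>
       lagrangian f g A B c xs ys ls \<le> lagrangian f g A B c x y ls}"

definition TRIALS_solution ::
  "('x::real_inner \<Rightarrow> real) \<Rightarrow> ('y::real_inner \<Rightarrow> real) \<Rightarrow> ('x \<Rightarrow> 'z) \<Rightarrow> ('y \<Rightarrow> 'z) \<Rightarrow> 'z::real_inner \<Rightarrow>
   real \<Rightarrow> (real \<Rightarrow> real) \<Rightarrow> (real \<Rightarrow> real) \<Rightarrow> (real \<Rightarrow> real) \<Rightarrow> real \<Rightarrow>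
   (real \<Rightarrow> 'x) \<Rightarrow> (real \<Rightarrow> 'y) \<Rightarrow> (real \<Rightarrow> 'z) \<Rightarrow> bool" where
  "TRIALS_solution f g A B c \<mu> \<gamma> \<alpha> b t0 x y l \<longleftrightarrow>
    C2_from t0 x \<and> C2_from t0 y \<and> C2_from t0 l \<and>
    (\<forall>t\<ge>t0.
      ddt t0 (ddt t0 x) t + \<gamma> t *\<^sub>R ddt t0 x t
        + b t *\<^sub>R (grad f (x t)
            + adjoint A (l t + \<alpha> t *\<^sub>R ddt t0 l t + \<mu> *\<^sub>R (A (x t) + B (y t) - c))) = 0 \<and>
      ddt t0 (ddt t0 y) t + \<gamma> t *\<^sub>R ddt t0 y t
        + b t *\<^sub>R (grad g (y t)
            + adjoint B (l t + \<alpha> t *\<^sub>R ddt t0 l t + \<mu> *\<^sub>R (A (x t) + B (y t) - c))) = 0 \<and>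
      ddt t0 (ddt t0 l) t + \<gamma> t *\<^sub>R ddt t0 l t
        - b t *\<^sub>R (A (x t + \<alpha> t *\<^sub>R ddt t0 x t) + B (y t + \<alpha> t *\<^sub>R ddt t0 y t) - c) = 0)"

end

theory Submission
  imports Defs
begin

text \<open>
  The three equations are one damped second-order equation
  \<open>w'' + \<gamma> w' + b D = 0\<close> for \<open>w = (x, y, \<lambda>)\<close> in the product space. Fix \<open>\<theta>\<close> in the
  space of multipliers, let \<open>w\<^sub>* = (x\<^sub>*, y\<^sub>*, \<theta>)\<close>, let \<open>r = A x + B y - c\<close>, and let \<open>\<Phi>\<close> be the
  augmented gap \<open>F(x, y) - F(x\<^sub>*, y\<^sub>*) + \<theta> \<bullet> r + (\<mu>/2) r \<bullet> r\<close> along the trajectory. The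
  extrapolated terms \<open>\<alpha> \<lambda>'\<close>, \<open>\<alpha> x'\<close>, \<open>\<alpha> y'\<close> of the system are made so that the multipliers
  \<open>\<lambda>\<close> and \<open>\<lambda>'\<close> cancel from \<open>D \<bullet> (w - w\<^sub>* + \<alpha> w')\<close>; convexity then gives
  \<open>D \<bullet> (w - w\<^sub>* + \<alpha> w') \<ge> \<Phi> + \<alpha> \<Phi>'\<close> (\<open>augmented_lagrangian_monotonicity\<close>).

  In the Lyapunov analysis (\<open>damped_inertial_decay\<close>), the equation turns \<open>w''\<close> into \<open>D\<close>, and
  \<open>D\<close> is controlled by this one inequality. With \<open>a = \<alpha>\<^sup>2 \<sigma>\<^sup>2 b\<close> and \<open>v = \<sigma> (w - w\<^sub>*) + \<alpha> \<sigma> w'\<close>, the energy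
  \<open>E = a \<Phi> + v \<bullet> v / 2 + \<xi> |w - w\<^sub>*|\<^sup>2 / 2\<close>, where \<open>\<xi>\<close> is chosen so that the mixed terms
  \<open>(w - w\<^sub>*) \<bullet> w'\<close> cancel in \<open>E'\<close>, satisfies \<open>E' \<le> (a' - a/\<alpha>) \<Phi>\<close>: the sign of the remaining
  terms is \<open>G2\<close> and \<open>G3\<close>. By \<open>G1\<close>, \<open>\<xi> \<ge> 0\<close> and therefore \<open>a \<Phi> \<le> E\<close>; by \<open>G4_plus\<close>,
  \<open>a' - a/\<alpha> \<ge> 0\<close>. So wherever \<open>a > 0\<close> one has \<open>E' \<le> (a'/a - 1/\<alpha>) E\<close>, and the function
  \<open>(E/a) exp (\<integral> 1/\<alpha>)\<close>, which dominates \<open>\<Phi> exp (\<integral> 1/\<alpha>)\<close>, decreases.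
  The energy itself may grow, and \<open>\<Phi>\<close> may be negative.

  Because no sign of \<open>\<Phi>\<close> enters, \<open>\<theta>\<close> is free. The saddle multiplier \<open>\<theta> = \<lambda>\<^sub>*\<close> makes
  \<open>\<Phi>\<close> a sum of two non-negative terms, the Lagrangian gap and \<open>(\<mu>/2) |r|\<^sup>2\<close>, and bounds both.
  The choice \<open>\<theta> = 0\<close> leaves the objective itself and gives its upper bound with the full rate;
  going through \<open>\<lambda>\<^sub>*\<close> there would cost half of the exponent. For the lower bound,
  \<open>F - F\<^sub>* = gap - \<lambda>\<^sub>* \<bullet> r \<ge> - |\<lambda>\<^sub>*| |r|\<close>.
\<close>

section \<open>Adjoints in Hilbert spaces\<close>

text \<open>
  The vector representing \<open>\<phi>\<close> is the minimiser of \<open>|x|\<^sup>2 - 2 \<phi> x\<close>. A minimising sequence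
  converges by the parallelogram law and completeness, and the vanishing of the derivative in
  every direction at the minimum is the representation.
\<close>
lemma riesz_representation:
  fixes \<phi> :: "'a::{real_inner,complete_space} \<Rightarrow> real"
  assumes "bounded_linear \<phi>"
  shows "\<exists>u. \<forall>h. \<phi> h = h \<bullet> u"
proof -
  interpret \<phi>: bounded_linear \<phi> by fact
  define J where "J x = x \<bullet> x - 2 * \<phi> x" for x
  define m where "m = Inf (range J)"
  obtain K where K: "\<And>x. \<bar>\<phi> x\<bar> \<le> norm x * K"
    using \<phi>.bounded by auto
  have "- K\<^sup>2 \<le> J x" for x
  proof -
    have "0 \<le> (norm x - K)\<^sup>2" by simp
    also have "\<dots> = x \<bullet> x - 2 * (norm x * K) + K\<^sup>2"
      by (simp add: power2_diff power2_norm_eq_inner)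
    also have "\<dots> \<le> x \<bullet> x - 2 * \<phi> x + K\<^sup>2"
      using K[of x] by linarith
    finally show ?thesis by (simp add: J_def)
  qed
  then have bdd: "bdd_below (range J)" by (intro bdd_belowI2)
  have m_le: "m \<le> J x" for x
    unfolding m_def using bdd by (intro cInf_lower) auto
  have "\<exists>x. J x < m + 1 / Suc n" for n
    using cInf_lessD[of "range J" "m + 1 / Suc n"] by (auto simp: m_def)
  then obtain X where X: "\<And>n. J (X n) < m + 1 / Suc n" by metis
  \<comment> \<open>The parallelogram law at the midpoint, where \<open>J\<close> is at least \<open>m\<close>, turns near-optimality of
    two points into closeness.\<close>
  have parallelogram: "(norm (x - y))\<^sup>2 \<le> 2 * (J x - m) + 2 * (J y - m)" for x y
  proof -
    define z where "z = (1/2) *\<^sub>R (x + y)"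
    have "2 * J x + 2 * J y - 4 * J z = (norm (x - y))\<^sup>2"
      by (simp add: J_def z_def \<phi>.scaleR \<phi>.add power2_norm_eq_inner inner_simps inner_commute
          field_simps)
    then show ?thesis using m_le[of z] by simp
  qed
  have "Cauchy X"
  proof (rule metric_CauchyI)
    fix e :: real assume "0 < e"
    then obtain N where N: "4 / e\<^sup>2 < real N" using reals_Archimedean2 by blast
    have "dist (X i) (X j) < e" if "i \<ge> N" "j \<ge> N" for i j
    proof -
      have small: "1 / Suc k \<le> 1 / Suc N" if "k \<ge> N" for k
        using that by (simp add: frac_le)
      have "4 < e\<^sup>2 * Suc N"
        using N \<open>0 < e\<close> by (simp add: field_simps) (smt (verit) zero_less_power2)
      then have "4 / Suc N < e\<^sup>2" by (simp add: field_simps)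
      then have "(norm (X i - X j))\<^sup>2 < e\<^sup>2"
        using parallelogram[of "X i" "X j"] X[of i] X[of j] small[OF that(1)] small[OF that(2)]
        by simp
      then show ?thesis
        using \<open>0 < e\<close> by (simp add: dist_norm power_less_imp_less_base)
    qed
    then show "\<exists>M. \<forall>i\<ge>M. \<forall>j\<ge>M. dist (X i) (X j) < e" by blast
  qed
  then obtain u where u: "X \<longlonglongrightarrow> u"
    using Cauchy_convergent convergent_def by blast
  have "(\<lambda>n. J (X n)) \<longlonglongrightarrow> J u"
    unfolding J_def by (intro tendsto_intros \<phi>.tendsto u)
  moreover have "(\<lambda>n. m + 1 / Suc n) \<longlonglongrightarrow> m + 0"
    by (intro tendsto_intros LIMSEQ_Suc lim_1_over_n)
  ultimately have "J u \<le> m"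
    using LIMSEQ_le[of "\<lambda>n. J (X n)" "J u" "\<lambda>n. m + 1 / Suc n" m] X
    by (auto intro: less_imp_le)
  then have min: "J u \<le> J x" for x using m_le[of x] by linarith
  have "\<phi> h = h \<bullet> u" for h
  proof -
    have "((\<lambda>s. J (u + s *\<^sub>R h)) has_real_derivative 2 * (h \<bullet> u) - 2 * \<phi> h) (at 0)"
      unfolding J_def \<phi>.add \<phi>.scaleR inner_simps
      by (auto intro!: derivative_eq_intros simp: inner_commute)
    from DERIV_local_min[OF this, of 1] have "2 * (h \<bullet> u) - 2 * \<phi> h = 0"
      using min by simp
    then show ?thesis by simp
  qed
  then show ?thesis by blast
qed

text \<open>
  The constant \<open>adjoint\<close> is a choice among maps with the adjoint property, so it has this property
  once one such map exists; the Riesz representation of \<open>h \<mapsto> A h \<bullet> z\<close> provides it.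
\<close>
lemma inner_adjoint_right:
  fixes A :: "'a::{real_inner,complete_space} \<Rightarrow> 'b::real_inner"
  assumes "bounded_linear A"
  shows "h \<bullet> adjoint A z = A h \<bullet> z"
proof -
  have "\<exists>u. \<forall>h. A h \<bullet> z = h \<bullet> u" for z
    by (intro riesz_representation bounded_linear_compose[OF bounded_linear_inner_left assms,
          unfolded o_def])
  then have "\<exists>A'. \<forall>h z. A h \<bullet> z = h \<bullet> A' z" by metis
  then have "\<forall>h z. A h \<bullet> z = h \<bullet> adjoint A z"
    unfolding adjoint_def by (rule someI_ex)
  then show ?thesis by simp
qed

section \<open>Gradients\<close>

lemma GDERIV_compose_curve:
  assumes "GDERIV f (x t) :> G" and "(x has_vector_derivative v) (at t within S)"
  shows "((\<lambda>s. f (x s)) has_real_derivative v \<bullet> G) (at t within S)"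
proof -
  have "((f \<circ> x) has_derivative (\<lambda>h. h \<bullet> G) \<circ> (\<lambda>s. s *\<^sub>R v)) (at t within S)"
    using assms unfolding gderiv_def has_vector_derivative_def
    by (intro diff_chain_within) (auto intro: has_derivative_at_withinI)
  then show ?thesis
    by (simp add: has_field_derivative_def o_def mult.commute[of _ "v \<bullet> G"]) 
qed

text \<open>The one-variable tangent inequality on the segment from \<open>x\<close> to \<open>y\<close>, read at its end.\<close>
lemma convex_on_imp_above_gradient:
  fixes f :: "'a::real_inner \<Rightarrow> real"
  assumes "convex_on UNIV f" and "GDERIV f x :> G"
  shows "f x + (y - x) \<bullet> G \<le> f y"
proof -
  let ?p = "\<lambda>s::real. x + s *\<^sub>R (y - x)"
  have "convex_on UNIV (\<lambda>s. f (?p s))"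
  proof (rule convex_onI)
    fix t r s :: real assume t: "0 < t" "t < 1"
    have "?p ((1 - t) *\<^sub>R r + t *\<^sub>R s) = (1 - t) *\<^sub>R ?p r + t *\<^sub>R ?p s"
      by (simp add: algebra_simps)
    then show "f (?p ((1 - t) *\<^sub>R r + t *\<^sub>R s)) \<le> (1 - t) * f (?p r) + t * f (?p s)"
      using convex_onD[OF assms(1), of t "?p r" "?p s"] t by simp
  qed simp
  moreover have "((\<lambda>s. f (?p s)) has_real_derivative (y - x) \<bullet> G) (at 0)"
    using assms(2)
    by (intro GDERIV_compose_curve) (auto intro!: derivative_eq_intros)
  ultimately show ?thesis
    using convex_on_imp_above_tangent[of UNIV "\<lambda>s. f (?p s)" 0 1 "(y - x) \<bullet> G"] by simp
qed

section \<open>Calculus on a half-line\<close>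

lemma has_real_derivative_halfline_interior:
  fixes h :: "real \<Rightarrow> real"
  assumes "(h has_real_derivative d) (at t within {t0..})" and "t0 < t"
  shows "(h has_real_derivative d) (at t)"
  using assms at_within_interior[of t "{t0..}"] by simp

lemma decreasing_on_halfline:
  fixes h h' :: "real \<Rightarrow> real"
  assumes "\<And>s. t0 \<le> s \<Longrightarrow> (h has_real_derivative h' s) (at s within {t0..})"
    and "\<And>s. r \<le> s \<Longrightarrow> h' s \<le> 0"
    and "t0 \<le> r" "r \<le> t"
  shows "h t \<le> h r"
proof (rule DERIV_nonpos_imp_decreasing_open[OF \<open>r \<le> t\<close>])
  fix s assume "r < s" "s < t"
  then show "\<exists>y. DERIV h s :> y \<and> y \<le> 0"
    using assms has_real_derivative_halfline_interior[OF assms(1)]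
    by (intro exI[of _ "h' s"]) auto
next
  have "continuous_on {t0..} h"
    using assms(1) by (intro DERIV_continuous_on) auto
  then show "continuous_on {r..t} h"
    by (rule continuous_on_subset) (use assms in auto)
qed

lemma integral_has_real_derivative_halfline:
  fixes h :: "real \<Rightarrow> real"
  assumes "continuous_on {t0..} h" and "t0 \<le> t"
  shows "((\<lambda>t. integral {t0..t} h) has_real_derivative h t) (at t within {t0..})"
proof -
  have "((\<lambda>t. integral {t0..t} h) has_real_derivative h t) (at t within {t0..t+1})"
    using assms by (intro integral_has_real_derivative) (auto intro: continuous_on_subset)
  moreover have "at t within {t0..t+1} = at t within {t0..}"
    by (rule at_within_nhd[of _ "{..<t+1}"]) auto
  ultimately show ?thesis by simp
qed

lemma ddt_works:
  assumes "u differentiable_on {t0..}" and "t0 \<le> t"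
  shows "(u has_vector_derivative ddt t0 u t) (at t within {t0..})"
  using assms by (auto simp: differentiable_on_def vector_derivative_works)

lemma ddt_works_real:
  fixes u :: "real \<Rightarrow> real"
  assumes "u differentiable_on {t0..}" and "t0 \<le> t"
  shows "(u has_real_derivative ddt t0 u t) (at t within {t0..})"
  using ddt_works[OF assms] by (simp add: has_real_derivative_iff_has_vector_derivative)

section \<open>Energy decay for a damped inertial system\<close>

text \<open>
  Here \<open>u\<close>, \<open>p\<close>, \<open>q\<close> stand for \<open>w - w\<^sub>*\<close>, \<open>w'\<close>, \<open>w''\<close> at one instant. The left-hand side is
  \<open>v \<bullet> v' + \<xi> (u \<bullet> p)\<close>, the part of \<open>E'\<close> that comes from differentiating \<open>v\<close> and
  \<open>w - w\<^sub>*\<close>. The value of \<open>\<xi>\<close> is forced: it cancels the coefficient of \<open>u \<bullet> p\<close> in \<open>v \<bullet> v'\<close>.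
\<close>
lemma energy_derivative_identity:
  fixes u p q D :: "'h::real_inner" and \<alpha> \<alpha>' \<sigma> \<sigma>' \<gamma> b :: real
  assumes "q + \<gamma> *\<^sub>R p + b *\<^sub>R D = 0"
  shows "(\<sigma> *\<^sub>R u + (\<alpha> * \<sigma>) *\<^sub>R p) \<bullet>
           (\<sigma>' *\<^sub>R u + \<sigma> *\<^sub>R p + (\<alpha>' * \<sigma> + \<alpha> * \<sigma>') *\<^sub>R p + (\<alpha> * \<sigma>) *\<^sub>R q)
         + (\<sigma> * (\<sigma> * (\<gamma> * \<alpha> - \<alpha>') - 2 * \<alpha> * \<sigma>') - \<sigma>\<^sup>2) * (u \<bullet> p)
       = \<sigma> * \<sigma>' * (u \<bullet> u) - \<alpha> * \<sigma> * (\<sigma> * (\<gamma> * \<alpha> - \<alpha>' - 1) - \<alpha> * \<sigma>') * (p \<bullet> p)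
         - \<alpha> * \<sigma>\<^sup>2 * b * (D \<bullet> (u + \<alpha> *\<^sub>R p))"
proof -
  have q: "q = - (\<gamma> *\<^sub>R p + b *\<^sub>R D)"
    using assms by (simp only: add.assoc eq_neg_iff_add_eq_0)
  show ?thesis
    unfolding q
    by (simp add: inner_simps inner_commute[of p u] inner_commute[of D u] inner_commute[of D p]
        algebra_simps power2_eq_square)
qed

text \<open>
  The Lyapunov argument, for any second-order system in an inner product space whose force \<open>D\<close>
  satisfies the inequality \<open>mono\<close>. For \<open>D\<close> the gradient of a convex function at \<open>w\<close> and \<open>\<Phi>\<close> its excess
  over the value at \<open>ws\<close>, this inequality is convexity plus the chain rule.
\<close>
lemma damped_inertial_decay:
  fixes w w' w'' D :: "real \<Rightarrow> 'h::real_inner" and ws :: 'h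
    and \<alpha> \<alpha>' \<sigma> \<sigma>' \<gamma> b a' K' I \<Phi> \<Phi>' :: "real \<Rightarrow> real"
  defines "a \<equiv> \<lambda>t. (\<alpha> t)\<^sup>2 * (\<sigma> t)\<^sup>2 * b t"
    and "K \<equiv> \<lambda>t. \<sigma> t * (\<sigma> t * (\<gamma> t * \<alpha> t - \<alpha>' t) - 2 * \<alpha> t * \<sigma>' t)"
  assumes w: "\<And>t. t0 \<le> t \<Longrightarrow> (w has_vector_derivative w' t) (at t within {t0..})"
    and w': "\<And>t. t0 \<le> t \<Longrightarrow> (w' has_vector_derivative w'' t) (at t within {t0..})"
    and ode: "\<And>t. t0 \<le> t \<Longrightarrow> w'' t + \<gamma> t *\<^sub>R w' t + b t *\<^sub>R D t = 0"
    and \<Phi>: "\<And>t. t0 \<le> t \<Longrightarrow> (\<Phi> has_real_derivative \<Phi>' t) (at t within {t0..})"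
    and mono: "\<And>t. t0 \<le> t \<Longrightarrow> \<Phi> t + \<alpha> t * \<Phi>' t \<le> D t \<bullet> (w t - ws + \<alpha> t *\<^sub>R w' t)"
    and \<alpha>: "\<And>t. t0 \<le> t \<Longrightarrow> (\<alpha> has_real_derivative \<alpha>' t) (at t within {t0..})"
    and \<sigma>: "\<And>t. t0 \<le> t \<Longrightarrow> (\<sigma> has_real_derivative \<sigma>' t) (at t within {t0..})"
    and a: "\<And>t. t0 \<le> t \<Longrightarrow> (a has_real_derivative a' t) (at t within {t0..})"
    and K: "\<And>t. t0 \<le> t \<Longrightarrow> (K has_real_derivative K' t) (at t within {t0..})"
    and I: "\<And>t. t0 \<le> t \<Longrightarrow> (I has_real_derivative 1 / \<alpha> t) (at t within {t0..})"
    and \<alpha>_pos: "\<And>t. t0 \<le> t \<Longrightarrow> 0 < \<alpha> t"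
    and \<sigma>_nonneg: "\<And>t. t0 \<le> t \<Longrightarrow> 0 \<le> \<sigma> t"
    and b_nonneg: "\<And>t. t0 \<le> t \<Longrightarrow> 0 \<le> b t"
    and nondegenerate: "\<exists>t\<ge>t0. \<sigma> t * b t \<noteq> 0"
    and G1: "\<And>t. t0 \<le> t \<Longrightarrow> 0 \<le> \<sigma> t * (\<gamma> t * \<alpha> t - \<alpha>' t - 1) - 2 * \<alpha> t * \<sigma>' t"
    and G2: "\<And>t. t0 \<le> t \<Longrightarrow> 0 \<le> \<sigma> t * (\<gamma> t * \<alpha> t - \<alpha>' t - 1) - \<alpha> t * \<sigma>' t"
    and G3: "\<And>t. t0 \<le> t \<Longrightarrow> K' t \<le> 0"
    and G4_plus: "\<And>t. t0 \<le> t \<Longrightarrow> \<alpha> t * (\<sigma> t)\<^sup>2 * b t \<le> a' t"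
  shows "\<exists>C. \<forall>t\<ge>t0. \<Phi> t \<le> C * exp (- I t)"
proof -
  define v where "v = (\<lambda>t. \<sigma> t *\<^sub>R (w t - ws) + (\<alpha> t * \<sigma> t) *\<^sub>R w' t)"
  define E where "E = (\<lambda>t. a t * \<Phi> t + (v t \<bullet> v t) / 2
    + (K t - (\<sigma> t)\<^sup>2) * ((w t - ws) \<bullet> (w t - ws) / 2))"
  define E' where "E' = (\<lambda>t. a' t * \<Phi> t + a t * \<Phi>' t
    + v t \<bullet> (\<sigma>' t *\<^sub>R (w t - ws) + \<sigma> t *\<^sub>R w' t + (\<alpha>' t * \<sigma> t + \<alpha> t * \<sigma>' t) *\<^sub>R w' t
        + (\<alpha> t * \<sigma> t) *\<^sub>R w'' t)
    + (K' t - 2 * \<sigma> t * \<sigma>' t) / 2 * ((w t - ws) \<bullet> (w t - ws))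
    + (K t - (\<sigma> t)\<^sup>2) * ((w t - ws) \<bullet> w' t))"
  have E_deriv: "(E has_real_derivative E' t) (at t within {t0..})" if "t0 \<le> t" for t
  proof -
    have half_square: "((\<lambda>s. u s \<bullet> u s / 2) has_real_derivative u t \<bullet> u') (at t within {t0..})"
      if "(u has_vector_derivative u') (at t within {t0..})" for u :: "real \<Rightarrow> 'h" and u'
      using that unfolding has_vector_derivative_def has_field_derivative_def
      by (auto intro!: derivative_eq_intros simp: inner_commute)
    have wt: "((\<lambda>s. w s - ws) has_vector_derivative w' t) (at t within {t0..})"
      using w[OF that] by (auto intro!: derivative_eq_intros)
    have vt: "(v has_vector_derivative \<sigma>' t *\<^sub>R (w t - ws) + \<sigma> t *\<^sub>R w' t
        + (\<alpha>' t * \<sigma> t + \<alpha> t * \<sigma>' t) *\<^sub>R w' t + (\<alpha> t * \<sigma> t) *\<^sub>R w'' t) (at t within {t0..})"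
      unfolding v_def
      by (rule derivative_eq_intros refl wt \<alpha> \<sigma> w' that)+ (simp add: algebra_simps)
    show ?thesis
      unfolding E_def E'_def
      by (rule DERIV_cong[OF DERIV_add[OF
            DERIV_add[OF DERIV_mult[OF a \<Phi>] half_square[OF vt]]
            DERIV_mult[OF DERIV_diff[OF K DERIV_power[OF \<sigma>, of _ 2]] half_square[OF wt]]]])
        (use that in \<open>auto simp: field_simps\<close>)
  qed
  have E'_le: "E' t \<le> (a' t - \<alpha> t * (\<sigma> t)\<^sup>2 * b t) * \<Phi> t" if t: "t0 \<le> t" for t
  proof -
    let ?u = "w t - ws"
    have "E' t = a' t * \<Phi> t + a t * \<Phi>' t + K' t / 2 * (?u \<bullet> ?u)
        - \<alpha> t * \<sigma> t * (\<sigma> t * (\<gamma> t * \<alpha> t - \<alpha>' t - 1) - \<alpha> t * \<sigma>' t) * (w' t \<bullet> w' t)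
        - \<alpha> t * (\<sigma> t)\<^sup>2 * b t * (D t \<bullet> (?u + \<alpha> t *\<^sub>R w' t))"
      using energy_derivative_identity[OF ode[OF t], of "\<sigma> t" ?u "\<alpha> t" "\<sigma>' t" "\<alpha>' t"]
      unfolding E'_def v_def K_def by (simp add: field_simps)
    moreover have "K' t / 2 * (?u \<bullet> ?u) \<le> 0"
      using G3[OF t] by (simp add: mult_nonpos_nonneg)
    moreover have "0 \<le> \<alpha> t * \<sigma> t * (\<sigma> t * (\<gamma> t * \<alpha> t - \<alpha>' t - 1) - \<alpha> t * \<sigma>' t) * (w' t \<bullet> w' t)"
      using G2[OF t] \<alpha>_pos[OF t] \<sigma>_nonneg[OF t] by (intro mult_nonneg_nonneg) auto
    moreover have "\<alpha> t * (\<sigma> t)\<^sup>2 * b t * (\<Phi> t + \<alpha> t * \<Phi>' t)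
        \<le> \<alpha> t * (\<sigma> t)\<^sup>2 * b t * (D t \<bullet> (?u + \<alpha> t *\<^sub>R w' t))"
      using mono[OF t] \<alpha>_pos[OF t] b_nonneg[OF t] by (intro mult_left_mono) auto
    moreover have "a t * \<Phi>' t = \<alpha> t * (\<sigma> t)\<^sup>2 * b t * (\<alpha> t * \<Phi>' t)"
      by (simp add: a_def power2_eq_square)
    ultimately show ?thesis unfolding left_diff_distrib distrib_left by linarith
  qed
  have E_ge: "a t * \<Phi> t \<le> E t" if t: "t0 \<le> t" for t
  proof -
    have "K t - (\<sigma> t)\<^sup>2 = \<sigma> t * (\<sigma> t * (\<gamma> t * \<alpha> t - \<alpha>' t - 1) - 2 * \<alpha> t * \<sigma>' t)"
      by (simp add: K_def algebra_simps power2_eq_square)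
    also have "\<dots> \<ge> 0" using G1[OF t] \<sigma>_nonneg[OF t] by (rule mult_nonneg_nonneg[rotated])
    finally show ?thesis unfolding E_def by simp
  qed
  \<comment> \<open>The weight \<open>a\<close> may vanish on an initial interval, so the differential inequality is
    divided by \<open>a\<close> only from \<open>t1\<close> on; since \<open>a\<close> grows it stays positive there.\<close>
  obtain t1 where t1: "t0 \<le> t1" "\<sigma> t1 * b t1 \<noteq> 0"
    using nondegenerate by blast
  have a_pos: "0 < a t" if "t1 \<le> t" for t
  proof -
    have "- a t \<le> - a t1"
    proof (rule decreasing_on_halfline[where h = "\<lambda>s. - a s"])
      show "((\<lambda>s. - a s) has_real_derivative - a' s) (at s within {t0..})" if "t0 \<le> s" for s
        using a[OF that] by (rule DERIV_minus)
      show "- a' s \<le> 0" if "t1 \<le> s" for s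
      proof -
        have s: "t0 \<le> s" using that t1 by simp
        have "0 \<le> \<alpha> s * (\<sigma> s)\<^sup>2 * b s" using \<alpha>_pos[OF s] b_nonneg[OF s] by simp
        then show ?thesis using G4_plus[OF s] by simp
      qed
    qed (use t1 that in auto)
    moreover have "0 < a t1"
      using t1 \<alpha>_pos[of t1] b_nonneg[of t1] by (auto simp: a_def)
    ultimately show ?thesis by simp
  qed
  define h where "h = (\<lambda>t. E t / a t * exp (I t))"
  have late: "\<Phi> t * exp (I t) \<le> h t1" if t: "t1 \<le> t" for t
  proof -
    have "h t \<le> h t1"
    proof (rule decreasing_on_halfline[where h = h and ?t0.0 = t1])
      fix s assume "t1 \<le> s"
      then have s: "t1 \<le> s" "t0 \<le> s" using t1 by auto
      have within: "(k has_real_derivative d) (at s within {t1..})"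
        if "(k has_real_derivative d) (at s within {t0..})" for k d
        using that by (rule DERIV_subset) (use t1 in auto)
      show "(h has_real_derivative (E' s - E s * a' s / a s + E s / \<alpha> s) * exp (I s) / a s)
          (at s within {t1..})"
        unfolding h_def
        by (rule DERIV_cong[OF DERIV_mult[OF
              DERIV_divide[OF within[OF E_deriv[OF s(2)]] within[OF a[OF s(2)]]]
              DERIV_chain2[OF DERIV_exp within[OF I[OF s(2)]]]]])
          (use a_pos[OF s(1)] \<alpha>_pos[OF s(2)] in \<open>auto simp: field_simps power2_eq_square\<close>)
      have a_over: "\<alpha> s * (\<sigma> s)\<^sup>2 * b s = a s / \<alpha> s"
        using \<alpha>_pos[OF s(2)] by (simp add: a_def power2_eq_square)
      \<comment> \<open>Enlarging \<open>a * \<Phi>\<close> to \<open>E\<close> is legitimate for either sign of \<open>\<Phi>\<close>, because its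
        factor is non-negative.\<close>
      have "E' s \<le> (a' s - a s / \<alpha> s) * \<Phi> s"
        using E'_le[OF s(2)] by (simp add: a_over)
      also have "\<dots> = (a' s - a s / \<alpha> s) / a s * (a s * \<Phi> s)"
        using a_pos[OF s(1)] by simp
      also have "\<dots> \<le> (a' s - a s / \<alpha> s) / a s * E s"
        using E_ge[OF s(2)] G4_plus[OF s(2)] a_pos[OF s(1)]
        by (intro mult_left_mono) (auto simp: a_over)
      also have "\<dots> = E s * a' s / a s - E s / \<alpha> s"
        using a_pos[OF s(1)] by (simp add: field_simps)
      finally have "E' s - E s * a' s / a s + E s / \<alpha> s \<le> 0" by simp
      then show "(E' s - E s * a' s / a s + E s / \<alpha> s) * exp (I s) / a s \<le> 0"
        using a_pos[OF s(1)] by (intro divide_nonpos_pos mult_nonpos_nonneg) auto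
    qed (use t in auto)
    moreover have "\<Phi> t \<le> E t / a t"
      using E_ge[of t] a_pos[OF t] t t1 by (simp add: field_simps)
    ultimately show ?thesis
      by (smt (verit) h_def exp_gt_zero mult_right_mono)
  qed
  \<comment> \<open>On the compact initial interval a bound comes from continuity alone.\<close>
  have "continuous_on {t0..} (\<lambda>t. \<Phi> t * exp (I t))"
    using \<Phi> I by (intro continuous_intros DERIV_continuous_on) auto
  then have "continuous_on {t0..t1} (\<lambda>t. \<Phi> t * exp (I t))"
    by (rule continuous_on_subset) auto
  then have "bdd_above ((\<lambda>t. \<Phi> t * exp (I t)) ` {t0..t1})"
    by (intro bounded_imp_bdd_above compact_imp_bounded compact_continuous_image) auto
  then obtain M where early: "\<And>t. t \<in> {t0..t1} \<Longrightarrow> \<Phi> t * exp (I t) \<le> M"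
    unfolding bdd_above_def by (metis imageI)
  have "\<Phi> t \<le> max M (h t1) * exp (- I t)" if "t0 \<le> t" for t
  proof -
    have "\<Phi> t * exp (I t) \<le> max M (h t1)"
      using early[of t] late[of t] that by (cases "t \<le> t1") (auto simp: le_max_iff_disj)
    then show ?thesis by (simp add: exp_minus field_simps)
  qed
  then show ?thesis by blast
qed

section \<open>Decay along trajectories of the augmented Lagrangian system\<close>

text \<open>
  Maximality in the multiplier, tested in the direction of the residual itself, forces
  feasibility; on the feasible set the Lagrangian is the objective, so minimality in \<open>(x, y)\<close>
  makes \<open>(xs, ys)\<close> a solution.
\<close>
lemma saddle_point_optimality:
  fixes c :: "'z::real_inner"
  assumes "(xs, ys, ls) \<in> saddle_points f g A B c"
  shows "A xs + B ys = c" and "optimal_value f g A B c = objective f g xs ys"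
proof -
  have max: "lagrangian f g A B c xs ys l \<le> lagrangian f g A B c xs ys ls"
    and min: "lagrangian f g A B c xs ys ls \<le> lagrangian f g A B c x y ls" for x y l
    using assms by (auto simp: saddle_points_def)
  let ?r = "A xs + B ys - c"
  have "?r \<bullet> ?r \<le> 0"
    using max[of "ls + ?r"] by (simp add: lagrangian_def inner_add_left)
  then show feasible: "A xs + B ys = c"
    by (metis inner_eq_zero_iff inner_ge_zero order_antisym right_minus_eq)
  show "optimal_value f g A B c = objective f g xs ys"
    unfolding optimal_value_def
  proof (rule cInf_eq_minimum)
    show "objective f g xs ys \<in> (\<lambda>(x, y). objective f g x y) ` feasible_set A B c"
      using feasible by (force simp: feasible_set_def)
    show "objective f g xs ys \<le> k"
      if k: "k \<in> (\<lambda>(x, y). objective f g x y) ` feasible_set A B c" for k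
    proof -
      obtain x y where "A x + B y = c" "k = objective f g x y"
        using k by (auto simp: feasible_set_def)
      then show ?thesis using min[of x y] feasible by (simp add: lagrangian_def)
    qed
  qed
qed

text \<open>
  Moving the adjoints across, the first two components contribute \<open>?R \<bullet> (l + \<alpha> l' + \<mu> r)\<close> with
  \<open>?R = r + \<alpha> r'\<close>, and the third contributes \<open>- ?R \<bullet> (l - \<theta> + \<alpha> l')\<close>. Their sum
  \<open>?R \<bullet> (\<theta> + \<mu> r)\<close> no longer contains \<open>l\<close> or \<open>l'\<close>, whatever \<open>\<theta>\<close> is. The gradient
  inequalities for \<open>f\<close> and \<open>g\<close> finish the proof.
\<close>
lemma augmented_lagrangian_monotonicity:
  fixes f :: "'x::{real_inner,complete_space} \<Rightarrow> real"
    and g :: "'y::{real_inner,complete_space} \<Rightarrow> real"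
    and A :: "'x \<Rightarrow> 'z::real_inner" and B :: "'y \<Rightarrow> 'z"
    and x x' xs Gf :: 'x and y y' ys Gg :: 'y and c l l' \<theta> :: 'z and \<alpha> \<mu> :: real
  assumes "convex_on UNIV f" "GDERIV f x :> Gf" "convex_on UNIV g" "GDERIV g y :> Gg"
    and A: "bounded_linear A" and B: "bounded_linear B"
    and feasible: "A xs + B ys = c" and "0 \<le> \<mu>"
  defines "r \<equiv> A x + B y - c" and "r' \<equiv> A x' + B y'"
  shows "(f x + g y - (f xs + g ys) + \<theta> \<bullet> r + \<mu> / 2 * (r \<bullet> r))
      + \<alpha> * (x' \<bullet> Gf + y' \<bullet> Gg + \<theta> \<bullet> r' + \<mu> * (r \<bullet> r'))
    \<le> (Gf + adjoint A (l + \<alpha> *\<^sub>R l' + \<mu> *\<^sub>R r), Gg + adjoint B (l + \<alpha> *\<^sub>R l' + \<mu> *\<^sub>R r),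
        - (A (x + \<alpha> *\<^sub>R x') + B (y + \<alpha> *\<^sub>R y') - c))
       \<bullet> ((x, y, l) - (xs, ys, \<theta>) + \<alpha> *\<^sub>R (x', y', l'))"
proof -
  interpret A: bounded_linear A by fact
  interpret B: bounded_linear B by fact
  let ?q = "l + \<alpha> *\<^sub>R l' + \<mu> *\<^sub>R r"
  let ?R = "r + \<alpha> *\<^sub>R r'"
  let ?zx = "x - xs + \<alpha> *\<^sub>R x'" and ?zy = "y - ys + \<alpha> *\<^sub>R y'"
  have residual: "A (x + \<alpha> *\<^sub>R x') + B (y + \<alpha> *\<^sub>R y') - c = ?R"
    by (simp add: r_def r'_def A.add A.scaleR B.add B.scaleR algebra_simps)
  have AB: "A ?zx + B ?zy = ?R"
    unfolding r_def r'_def feasible[symmetric]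
    by (simp add: A.add A.diff A.scaleR B.add B.diff B.scaleR algebra_simps)
  have pairing: "(u, v, - z) \<bullet> ((x, y, l) - (xs, ys, \<theta>) + \<alpha> *\<^sub>R (x', y', l'))
     = ?zx \<bullet> u + ?zy \<bullet> v - z \<bullet> (l - \<theta> + \<alpha> *\<^sub>R l')" for u v z
    by (simp add: inner_commute[of u] inner_commute[of v])
  have "(Gf + adjoint A ?q, Gg + adjoint B ?q, - ?R)
       \<bullet> ((x, y, l) - (xs, ys, \<theta>) + \<alpha> *\<^sub>R (x', y', l'))
     = ?zx \<bullet> Gf + ?zy \<bullet> Gg + (?zx \<bullet> adjoint A ?q + ?zy \<bullet> adjoint B ?q)
       - ?R \<bullet> (l - \<theta> + \<alpha> *\<^sub>R l')"
    unfolding pairing by (simp add: inner_add_right)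
  also have "?zx \<bullet> adjoint A ?q + ?zy \<bullet> adjoint B ?q = ?R \<bullet> ?q"
    using AB by (simp add: inner_adjoint_right A B flip: inner_add_left)
  also have "?zx \<bullet> Gf + ?zy \<bullet> Gg + ?R \<bullet> ?q - ?R \<bullet> (l - \<theta> + \<alpha> *\<^sub>R l')
     = (x - xs) \<bullet> Gf + (y - ys) \<bullet> Gg + \<theta> \<bullet> r + \<mu> * (r \<bullet> r)
       + \<alpha> * (x' \<bullet> Gf + y' \<bullet> Gg + \<theta> \<bullet> r' + \<mu> * (r \<bullet> r'))"
    by (simp add: inner_simps inner_commute[of r' r] inner_commute[of r \<theta>] inner_commute[of r' \<theta>]
        inner_commute[of r l] inner_commute[of r' l] inner_commute[of r l'] inner_commute[of r' l']
        algebra_simps)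
  finally have "(Gf + adjoint A ?q, Gg + adjoint B ?q, - ?R)
       \<bullet> ((x, y, l) - (xs, ys, \<theta>) + \<alpha> *\<^sub>R (x', y', l'))
     = (x - xs) \<bullet> Gf + (y - ys) \<bullet> Gg + \<theta> \<bullet> r + \<mu> * (r \<bullet> r)
       + \<alpha> * (x' \<bullet> Gf + y' \<bullet> Gg + \<theta> \<bullet> r' + \<mu> * (r \<bullet> r'))" .
  moreover have "f x - f xs \<le> (x - xs) \<bullet> Gf"
    using convex_on_imp_above_gradient[OF assms(1,2), of xs] by (simp add: inner_diff_left)
  moreover have "g y - g ys \<le> (y - ys) \<bullet> Gg"
    using convex_on_imp_above_gradient[OF assms(3,4), of ys] by (simp add: inner_diff_left)
  moreover have "0 \<le> \<mu> / 2 * (r \<bullet> r)"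
    using \<open>0 \<le> \<mu>\<close> by simp
  ultimately show ?thesis
    unfolding residual by linarith
qed

theorem theorem3p3:
  fixes f :: "'x::{real_inner,complete_space} \<Rightarrow> real"
    and g :: "'y::{real_inner,complete_space} \<Rightarrow> real"
    and A :: "'x \<Rightarrow> 'z::{real_inner,complete_space}"
    and B :: "'y \<Rightarrow> 'z"
    and c :: 'z
    and t0 \<mu> :: real
    and \<gamma> \<alpha> b \<sigma> :: "real \<Rightarrow> real"
    and x :: "real \<Rightarrow> 'x" and y :: "real \<Rightarrow> 'y" and l :: "real \<Rightarrow> 'z"
    and xs :: 'x and ys :: 'y and ls :: 'z
  assumes "convex_on UNIV f" and "C1_functional f"
    and "convex_on UNIV g" and "C1_functional g"
    and "bounded_linear A" and "bounded_linear B"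
    and "solution_set f g A B c \<noteq> {}"
    and "\<mu> > 0"
    and "C1_from t0 \<gamma>" and "\<forall>t\<ge>t0. \<gamma> t \<ge> 0"
    and "C1_from t0 \<alpha>" and "\<forall>t\<ge>t0. \<alpha> t > 0"
    and "C1_from t0 b" and "\<forall>t\<ge>t0. b t \<ge> 0"
    and "\<sigma> differentiable_on {t0..}" and "\<forall>t\<ge>t0. \<sigma> t \<ge> 0"
    and nondegenerate: "\<exists>t\<ge>t0. \<sigma> t * b t \<noteq> 0"
    and G1: "\<forall>t\<ge>t0. \<sigma> t * (\<gamma> t * \<alpha> t - ddt t0 \<alpha> t - 1) - 2 * \<alpha> t * ddt t0 \<sigma> t \<ge> 0"
    and G2: "\<forall>t\<ge>t0. \<sigma> t * (\<gamma> t * \<alpha> t - ddt t0 \<alpha> t - 1) - \<alpha> t * ddt t0 \<sigma> t \<ge> 0"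
    and G3_differentiable:
      "(\<lambda>t. \<sigma> t * (\<sigma> t * (\<gamma> t * \<alpha> t - ddt t0 \<alpha> t) - 2 * \<alpha> t * ddt t0 \<sigma> t))
         differentiable_on {t0..}"
    and G3: "\<forall>t\<ge>t0.
      - ddt t0 (\<lambda>s. \<sigma> s * (\<sigma> s * (\<gamma> s * \<alpha> s - ddt t0 \<alpha> s) - 2 * \<alpha> s * ddt t0 \<sigma> s)) t \<ge> 0"
    and G4_plus: "\<forall>t\<ge>t0.
      ddt t0 (\<lambda>s. (\<alpha> s)\<^sup>2 * (\<sigma> s)\<^sup>2 * b s) t - \<alpha> t * (\<sigma> t)\<^sup>2 * b t \<ge> 0"
    and "(xs, ys, ls) \<in> saddle_points f g A B c"
    and "bdd_below (range (\<lambda>(u, v). objective f g u v))"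
    and "TRIALS_solution f g A B c \<mu> \<gamma> \<alpha> b t0 x y l"
  shows
    "(\<lambda>t. lagrangian f g A B c (x t) (y t) ls - lagrangian f g A B c xs ys ls)
        \<in> O[principal {t0..}](\<lambda>t. exp (- integral {t0..t} (\<lambda>s. 1 / \<alpha> s))) \<and>
     (\<lambda>t. (norm (A (x t) + B (y t) - c))\<^sup>2)
        \<in> O[principal {t0..}](\<lambda>t. exp (- integral {t0..t} (\<lambda>s. 1 / \<alpha> s))) \<and>
     (\<exists>C1>0. \<exists>C2>0. \<forall>t\<ge>t0.
        - C1 * exp (- integral {t0..t} (\<lambda>s. 1 / (2 * \<alpha> s)))
          \<le> objective f g (x t) (y t) - optimal_value f g A B c \<and>
        objective f g (x t) (y t) - optimal_value f g A B c
          \<le> C2 * exp (- integral {t0..t} (\<lambda>s. 1 / \<alpha> s)))"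
proof -
  interpret A: bounded_linear A by (rule assms)
  interpret B: bounded_linear B by (rule assms)
  define I where "I = (\<lambda>t. integral {t0..t} (\<lambda>s. 1 / \<alpha> s))"
  define r where "r = (\<lambda>t. A (x t) + B (y t) - c)"
  define r' where "r' = (\<lambda>t. A (ddt t0 x t) + B (ddt t0 y t))"
  define q where "q = (\<lambda>t. l t + \<alpha> t *\<^sub>R ddt t0 l t + \<mu> *\<^sub>R r t)"
  define D where "D = (\<lambda>t. (grad f (x t) + adjoint A (q t), grad g (y t) + adjoint B (q t),
    - (A (x t + \<alpha> t *\<^sub>R ddt t0 x t) + B (y t + \<alpha> t *\<^sub>R ddt t0 y t) - c)))"
  note saddle = saddle_point_optimality[OF assms(23)]
  have \<alpha>_diff: "\<alpha> differentiable_on {t0..}" and b_diff: "b differentiable_on {t0..}"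
    using assms by (auto simp: C1_from_def)
  have \<alpha>_pos: "0 < \<alpha> t" if "t0 \<le> t" for t using assms(12) that by simp
  have deriv_I: "(I has_real_derivative 1 / \<alpha> t) (at t within {t0..})" if "t0 \<le> t" for t
    unfolding I_def
    using \<alpha>_diff \<alpha>_pos that
    by (intro integral_has_real_derivative_halfline continuous_intros
        differentiable_imp_continuous_on) fastforce+
  have traj: "(x has_vector_derivative ddt t0 x t) (at t within {t0..})"
    "(y has_vector_derivative ddt t0 y t) (at t within {t0..})"
    "(l has_vector_derivative ddt t0 l t) (at t within {t0..})"
    "(ddt t0 x has_vector_derivative ddt t0 (ddt t0 x) t) (at t within {t0..})"
    "(ddt t0 y has_vector_derivative ddt t0 (ddt t0 y) t) (at t within {t0..})"
    "(ddt t0 l has_vector_derivative ddt t0 (ddt t0 l) t) (at t within {t0..})"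
    if "t0 \<le> t" for t
    using assms(25) that unfolding TRIALS_solution_def C2_from_def C1_from_def
    by (auto intro!: ddt_works)
  have decay: "\<exists>C. \<forall>t\<ge>t0. objective f g (x t) (y t) - objective f g xs ys
      + \<theta> \<bullet> r t + \<mu> / 2 * (r t \<bullet> r t) \<le> C * exp (- I t)" for \<theta>
  proof (rule damped_inertial_decay[where w = "\<lambda>t. (x t, y t, l t)" and ws = "(xs, ys, \<theta>)"
        and w' = "\<lambda>t. (ddt t0 x t, ddt t0 y t, ddt t0 l t)"
        and w'' = "\<lambda>t. (ddt t0 (ddt t0 x) t, ddt t0 (ddt t0 y) t, ddt t0 (ddt t0 l) t)"
        and D = D and I = I and \<alpha> = \<alpha> and \<sigma> = \<sigma> and \<gamma> = \<gamma> and b = b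
        and \<alpha>' = "ddt t0 \<alpha>" and \<sigma>' = "ddt t0 \<sigma>"
        and a' = "ddt t0 (\<lambda>s. (\<alpha> s)\<^sup>2 * (\<sigma> s)\<^sup>2 * b s)"
        and K' = "ddt t0 (\<lambda>s. \<sigma> s * (\<sigma> s * (\<gamma> s * \<alpha> s - ddt t0 \<alpha> s) - 2 * \<alpha> s * ddt t0 \<sigma> s))"
        and \<Phi>' = "\<lambda>t. ddt t0 x t \<bullet> grad f (x t) + ddt t0 y t \<bullet> grad g (y t)
          + \<theta> \<bullet> r' t + \<mu> * (r t \<bullet> r' t)"])
    fix t assume t: "t0 \<le> t"
    have grads: "GDERIV f (x t) :> grad f (x t)" "GDERIV g (y t) :> grad g (y t)"
      using assms(2,4) by (auto simp: C1_functional_def)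
    show "((\<lambda>t. (x t, y t, l t)) has_vector_derivative
        (ddt t0 x t, ddt t0 y t, ddt t0 l t)) (at t within {t0..})"
      "((\<lambda>t. (ddt t0 x t, ddt t0 y t, ddt t0 l t)) has_vector_derivative
        (ddt t0 (ddt t0 x) t, ddt t0 (ddt t0 y) t, ddt t0 (ddt t0 l) t)) (at t within {t0..})"
      by (intro has_vector_derivative_Pair traj t)+
    show "(ddt t0 (ddt t0 x) t, ddt t0 (ddt t0 y) t, ddt t0 (ddt t0 l) t)
        + \<gamma> t *\<^sub>R (ddt t0 x t, ddt t0 y t, ddt t0 l t) + b t *\<^sub>R D t = 0"
      using assms(25) t by (simp add: TRIALS_solution_def D_def q_def r_def zero_prod_def
          del: minus_diff_eq)
    have r_deriv: "(r has_vector_derivative r' t) (at t within {t0..})"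
      unfolding r_def r'_def
      by (auto intro!: derivative_eq_intros A.has_vector_derivative B.has_vector_derivative traj t)
    have "((\<lambda>t. \<theta> \<bullet> r t) has_real_derivative \<theta> \<bullet> r' t) (at t within {t0..})"
      "((\<lambda>t. r t \<bullet> r t) has_real_derivative 2 * (r t \<bullet> r' t)) (at t within {t0..})"
      using r_deriv unfolding has_vector_derivative_def has_field_derivative_def
      by (auto intro!: derivative_eq_intros simp: inner_commute)
    then show "((\<lambda>t. objective f g (x t) (y t) - objective f g xs ys
          + \<theta> \<bullet> r t + \<mu> / 2 * (r t \<bullet> r t)) has_real_derivative
        ddt t0 x t \<bullet> grad f (x t) + ddt t0 y t \<bullet> grad g (y t)
          + \<theta> \<bullet> r' t + \<mu> * (r t \<bullet> r' t)) (at t within {t0..})"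
      unfolding objective_def
      by (auto intro!: derivative_eq_intros GDERIV_compose_curve[OF grads(1) traj(1)[OF t]]
          GDERIV_compose_curve[OF grads(2) traj(2)[OF t]])
    show "objective f g (x t) (y t) - objective f g xs ys + \<theta> \<bullet> r t + \<mu> / 2 * (r t \<bullet> r t)
        + \<alpha> t * (ddt t0 x t \<bullet> grad f (x t) + ddt t0 y t \<bullet> grad g (y t)
          + \<theta> \<bullet> r' t + \<mu> * (r t \<bullet> r' t))
      \<le> D t \<bullet> ((x t, y t, l t) - (xs, ys, \<theta>) + \<alpha> t *\<^sub>R (ddt t0 x t, ddt t0 y t, ddt t0 l t))"
      unfolding objective_def D_def q_def r_def r'_def
      using assms(1,3,5,6,8) grads saddle(1)
      by (intro augmented_lagrangian_monotonicity) auto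
    show "(\<alpha> has_real_derivative ddt t0 \<alpha> t) (at t within {t0..})"
      "(\<sigma> has_real_derivative ddt t0 \<sigma> t) (at t within {t0..})"
      by (intro ddt_works_real \<alpha>_diff assms(15) t)+
    show "((\<lambda>t. (\<alpha> t)\<^sup>2 * (\<sigma> t)\<^sup>2 * b t) has_real_derivative
        ddt t0 (\<lambda>s. (\<alpha> s)\<^sup>2 * (\<sigma> s)\<^sup>2 * b s) t) (at t within {t0..})"
      unfolding power2_eq_square
      by (intro ddt_works_real differentiable_on_mult \<alpha>_diff b_diff assms(15) t)
    show "((\<lambda>t. \<sigma> t * (\<sigma> t * (\<gamma> t * \<alpha> t - ddt t0 \<alpha> t) - 2 * \<alpha> t * ddt t0 \<sigma> t))
        has_real_derivative
        ddt t0 (\<lambda>s. \<sigma> s * (\<sigma> s * (\<gamma> s * \<alpha> s - ddt t0 \<alpha> s) - 2 * \<alpha> s * ddt t0 \<sigma> s)) t)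
        (at t within {t0..})"
      by (intro ddt_works_real G3_differentiable t)
  qed (use assms deriv_I in auto)

  have gap: "lagrangian f g A B c (x t) (y t) ls - lagrangian f g A B c xs ys ls
      = objective f g (x t) (y t) - objective f g xs ys + ls \<bullet> r t" for t
    by (simp add: lagrangian_def r_def saddle(1))
  have gap_nonneg: "0 \<le> lagrangian f g A B c (x t) (y t) ls - lagrangian f g A B c xs ys ls" for t
    using assms(23) by (simp add: saddle_points_def)
  \<comment> \<open>The two useful multipliers: \<open>ls\<close> for the Lagrangian gap and the residual, \<open>0\<close> for the
    upper bound on the objective.\<close>
  obtain C where C: "\<And>t. t0 \<le> t \<Longrightarrow>
      lagrangian f g A B c (x t) (y t) ls - lagrangian f g A B c xs ys ls
      + \<mu> / 2 * (norm (r t))\<^sup>2 \<le> C * exp (- I t)"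
    using decay[of ls] unfolding gap power2_norm_eq_inner by blast
  obtain C0 where C0: "\<And>t. t0 \<le> t \<Longrightarrow> objective f g (x t) (y t) - objective f g xs ys
      + \<mu> / 2 * (norm (r t))\<^sup>2 \<le> C0 * exp (- I t)"
    using decay[of 0] unfolding power2_norm_eq_inner by auto
  have gap_le: "lagrangian f g A B c (x t) (y t) ls - lagrangian f g A B c xs ys ls
      \<le> C * exp (- I t)" if "t0 \<le> t" for t
    using C[OF that] \<open>\<mu> > 0\<close> by (smt (verit) zero_le_power2 mult_nonneg_nonneg divide_nonneg_nonneg)
  have r_le: "(norm (r t))\<^sup>2 \<le> 2 * C / \<mu> * exp (- I t)" if "t0 \<le> t" for t
  proof -
    have "\<mu> / 2 * (norm (r t))\<^sup>2 \<le> C * exp (- I t)"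
      using C[OF that] gap_nonneg[of t] by linarith
    then show ?thesis using \<open>\<mu> > 0\<close> by (simp add: field_simps)
  qed
  have "0 \<le> C * exp (- I t0)"
    using gap_le[of t0] gap_nonneg[of t0] by linarith
  then have "0 \<le> C" by (simp add: zero_le_mult_iff)
  have half: "- integral {t0..t} (\<lambda>s. 1 / (2 * \<alpha> s)) = - I t / 2" for t
    using integral_mult_right[of "{t0..t}" "1/2" "\<lambda>s. 1 / \<alpha> s"] by (simp add: I_def)
  \<comment> \<open>The summands \<open>1\<close> only make the constants positive.\<close>
  define C1 where "C1 = norm ls * sqrt (2 * C / \<mu>) + 1"
  define C2 where "C2 = \<bar>C0\<bar> + 1"
  have lower: "- C1 * exp (- I t / 2) \<le> objective f g (x t) (y t) - objective f g xs ys"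
    if "t0 \<le> t" for t
  proof -
    have "norm (r t) \<le> sqrt (2 * C / \<mu>) * exp (- I t / 2)"
    proof (rule power2_le_imp_le)
      show "(norm (r t))\<^sup>2 \<le> (sqrt (2 * C / \<mu>) * exp (- I t / 2))\<^sup>2"
        using r_le[OF that] \<open>0 \<le> C\<close> \<open>\<mu> > 0\<close>
        by (simp add: power_mult_distrib flip: exp_double)
    qed (use \<open>0 \<le> C\<close> \<open>\<mu> > 0\<close> in auto)
    then have "norm ls * norm (r t) \<le> norm ls * (sqrt (2 * C / \<mu>) * exp (- I t / 2))"
      by (rule mult_left_mono) simp
    also have "\<dots> \<le> C1 * exp (- I t / 2)"
      by (simp add: C1_def algebra_simps)
    finally have "ls \<bullet> r t \<le> C1 * exp (- I t / 2)"
      using norm_cauchy_schwarz[of ls "r t"] by linarith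
    then show ?thesis using gap[of t] gap_nonneg[of t] by simp
  qed
  have upper: "objective f g (x t) (y t) - objective f g xs ys \<le> C2 * exp (- I t)"
    if "t0 \<le> t" for t
  proof -
    have "0 \<le> \<mu> / 2 * (norm (r t))\<^sup>2" using \<open>\<mu> > 0\<close> by simp
    then have "objective f g (x t) (y t) - objective f g xs ys \<le> C0 * exp (- I t)"
      using C0[OF that] by linarith
    also have "\<dots> \<le> C2 * exp (- I t)"
      by (intro mult_right_mono) (auto simp: C2_def)
    finally show ?thesis .
  qed
  have "C1 > 0" "C2 > 0"
    using \<open>0 \<le> C\<close> \<open>\<mu> > 0\<close> by (auto simp: C1_def C2_def intro!: add_nonneg_pos)
  moreover have "\<forall>t\<ge>t0. - C1 * exp (- integral {t0..t} (\<lambda>s. 1 / (2 * \<alpha> s)))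
        \<le> objective f g (x t) (y t) - optimal_value f g A B c \<and>
      objective f g (x t) (y t) - optimal_value f g A B c
        \<le> C2 * exp (- integral {t0..t} (\<lambda>s. 1 / \<alpha> s))"
    unfolding saddle(2) half using lower upper by (simp add: I_def)
  moreover have "(\<lambda>t. lagrangian f g A B c (x t) (y t) ls - lagrangian f g A B c xs ys ls)
      \<in> O[principal {t0..}](\<lambda>t. exp (- integral {t0..t} (\<lambda>s. 1 / \<alpha> s)))"
    using gap_le gap_nonneg
    by (intro bigoI[of _ C]) (auto simp: eventually_principal I_def)
  moreover have "(\<lambda>t. (norm (A (x t) + B (y t) - c))\<^sup>2)
      \<in> O[principal {t0..}](\<lambda>t. exp (- integral {t0..t} (\<lambda>s. 1 / \<alpha> s)))"
    using r_le
    by (intro bigoI[of _ "2 * C / \<mu>"]) (auto simp: eventually_principal I_def r_def)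
  ultimately show ?thesis by blast
qed

end
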